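(* Let $n=2$, let $1>q_1>q_2>0$ and let $C\ge 2$ be an integer. For each of the two objectives ($\mathsf{SLM}_\tau$ and $\mathsf{EAM}_\tau$, considered separately) one can choose, for every positive integer $\tau$, an optimal policy $\pi^*=\pi^{*,\tau}$ for that objective with deadline $\tau$ whose first-round allocation $(x_1^*,x_2^* )=(x_1^*(\tau),x_2^*(\tau))=\pi^{*,\tau}_1(\{1,2\})$ satisfies: (1) $(x_1^*,x_2^* )=(C-1,1)$ for all sufficiently large $\tau$; moreover $(x_1^*,x_2^* )\ne (C,0)$ for every $\tau$; (2) $x_1^*$ is non-decreasing in $\tau$ and $x_2^*$ is non-increasing in $\tau$; (3) $x_1^*\ge x_2^*$ for every $\tau$.
   Context: Model. An instance has $n\ge1$ threats $[n]=\{1,\dots,n\}$, a per-round capacity $C\in\mathbb Z_{\ge1}$ of effectors, and difficulties $q=(q_i)\in[0,1)^n$, where $q_i$ is the probability that a single effector fails to neutralize threat $i$. Demands $L_1,\dots,L_n$ are independent, $L_i\sim\mathrm{Geom}(1-q_i)$ on $\{1,2,\dots\}$, i.e. $\Pr(L_i>k)=q_i^k$. $\mathcal M_t\subseteq[n]$ is the set of active threats at the start of round $t$, $\mathcal M_1=[n]$. A policy is $\pi=(\pi_t)_{t\ge1}$, where $\pi_t$ maps each subset $\mathcal M\subseteq[n]$ to a vector $\pi_t(\mathcal M)\in\mathbb Z_{\ge0}^n$ with $\sum_{i\in[n]}[\pi_t(\mathcal M)]_i\le C$ and, for every nonempty $\mathcal M$ and every $t$, $\sum_{i\in\mathcal M}[\pi_t(\mathcal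 M)]_i=C$; $\Pi$ is the set of all such policies. Under $\pi$, the round-$t$ allocation is $x^t=\pi_t(\mathcal M_t)$ and $\mathcal M_{t+1}=\{i\in\mathcal M_t:\sum_{\ell=1}^t x_i^\ell<L_i\}$ (equivalently, given $\mathcal M_t$ each $i\in\mathcal M_t$ survives round $t$ independently with probability $q_i^{x_i^t}$). Objectives, for a deadline $\tau\in\mathbb Z_{\ge1}$. Let $T^\pi=\min\{t:\sum_{\ell=1}^t x_i^\ell\ge L_i\ \forall i\in[n]\}$. $\mathsf{SLM}_\tau$: maximize over $\pi\in\Pi$ the value $V^\pi_{\mathsf{SLM}_\tau}=\Pr(T^\pi\le\tau)$. $\mathsf{EAM}_\tau$: maximize over $\pi\in\Pi$ the value $V^\pi_{\mathsf{EAM}_\tau}=\mathbb E\big[\sum_{i=1}^n\min\{\sum_{t=1}^\tau x_i^t,L_i\}\big]$. *)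

theory Defs
  imports "HOL-Probability.Probability"
begin

text \<open>
  A policy maps a round \<open>t \<ge> 1\<close> and a set of active threats to an allocation vector, of which
  only the entries indexed by \<open>{1..n}\<close> matter.
\<close>

type_synonym policy = "nat \<Rightarrow> nat set \<Rightarrow> nat \<Rightarrow> nat"

definition policies :: "nat \<Rightarrow> nat \<Rightarrow> policy set" where
  "policies n C = {\<pi>. \<forall>t\<ge>1. \<forall>M\<subseteq>{1..n}.
     (\<Sum>i\<in>{1..n}. \<pi> t M i) \<le> C \<and> (M \<noteq> {} \<longrightarrow> (\<Sum>i\<in>M. \<pi> t M i) = C)}"

text \<open>
  The library's geometric distribution counts the failures before the first success, hence the
  shift by \<open>Suc\<close>. The default value \<open>0\<close> is taken outside \<open>{1..n}\<close> only.
\<close>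

definition demands :: "nat \<Rightarrow> (nat \<Rightarrow> real) \<Rightarrow> (nat \<Rightarrow> nat) pmf" where
  "demands n q = Pi_pmf {1..n} 0 (\<lambda>i. map_pmf Suc (geometric_pmf (1 - q i)))"

text \<open>
  Active threats at the start of a round, for a realization \<open>L\<close> of the demands. Rounds are
  numbered from 1; the value at 0 is a dummy.
\<close>

fun active :: "nat \<Rightarrow> policy \<Rightarrow> (nat \<Rightarrow> nat) \<Rightarrow> nat \<Rightarrow> nat set" where
  "active n \<pi> L 0 = {1..n}"
| "active n \<pi> L (Suc 0) = {1..n}"
| "active n \<pi> L (Suc (Suc t)) =
     {i \<in> active n \<pi> L (Suc t). (\<Sum>l\<in>{1..Suc t}. \<pi> l (active n \<pi> L l) i) < L i}"

definition alloc :: "nat \<Rightarrow> policy \<Rightarrow> (nat \<Rightarrow> nat) \<Rightarrow> nat \<Rightarrow> nat \<Rightarrow> nat" where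
  "alloc n \<pi> L t = \<pi> t (active n \<pi> L t)"

text \<open>The infimum of the empty set is \<open>\<infinity>\<close>: not all threats are ever neutralized.\<close>

definition clear_time :: "nat \<Rightarrow> policy \<Rightarrow> (nat \<Rightarrow> nat) \<Rightarrow> enat" where
  "clear_time n \<pi> L =
     Inf (enat ` {t. 1 \<le> t \<and> (\<forall>i\<in>{1..n}. L i \<le> (\<Sum>l\<in>{1..t}. alloc n \<pi> L l i))})"

definition V_SLM :: "nat \<Rightarrow> (nat \<Rightarrow> real) \<Rightarrow> nat \<Rightarrow> policy \<Rightarrow> real" where
  "V_SLM n q \<tau> \<pi> = measure_pmf.prob (demands n q) {L. clear_time n \<pi> L \<le> enat \<tau>}"

definition V_EAM :: "nat \<Rightarrow> (nat \<Rightarrow> real) \<Rightarrow> nat \<Rightarrow> policy \<Rightarrow> real" where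
  "V_EAM n q \<tau> \<pi> = measure_pmf.expectation (demands n q)
     (\<lambda>L. \<Sum>i\<in>{1..n}. real (min (\<Sum>t\<in>{1..\<tau>}. alloc n \<pi> L t i) (L i)))"

definition optimal_policy :: "nat \<Rightarrow> nat \<Rightarrow> (policy \<Rightarrow> real) \<Rightarrow> policy \<Rightarrow> bool" where
  "optimal_policy n C V \<pi> \<longleftrightarrow> \<pi> \<in> policies n C \<and> (\<forall>\<pi>'\<in>policies n C. V \<pi>' \<le> V \<pi>)"

lemma prob_geometric_gt:
  fixes q :: real
  assumes "0 \<le> q" "q < 1"
  shows "measure_pmf.prob (map_pmf Suc (geometric_pmf (1 - q))) {k<..} = q ^ k"
proof -
  let ?G = "geometric_pmf (1 - q)"
  have "measure_pmf.prob ?G {..<k} = (\<Sum>j<k. q ^ j * (1 - q))"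
    using assms by (subst measure_measure_pmf_finite) auto
  also have "\<dots> = 1 - q ^ k"
    using assms by (simp add: sum_distrib_right[symmetric] sum_gp_strict)
  finally have "measure_pmf.prob ?G (- {..<k}) = q ^ k"
    using measure_pmf.prob_compl[of "{..<k}" ?G] by (simp add: Compl_eq_Diff_UNIV)
  moreover have "Suc -` {k<..} = - {..<k}"
    by auto
  ultimately show ?thesis
    by simp
qed

lemma prob_demand_gt:
  assumes "i \<in> {1..n}" "0 \<le> q i" "q i < 1"
  shows "measure_pmf.prob (demands n q) {L. k < L i} = q i ^ k"
proof -
  have "map_pmf (\<lambda>L. L i) (demands n q) = map_pmf Suc (geometric_pmf (1 - q i))"
    unfolding demands_def using assms by (subst Pi_pmf_component) auto
  then have "measure_pmf.prob (map_pmf (\<lambda>L. L i) (demands n q)) {k<..} = q i ^ k"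
    using prob_geometric_gt[of "q i" k] assms by simp
  then show ?thesis
    by (simp add: vimage_def)
qed

end

theory Submission
  imports Defs
begin

text \<open>
  Write \<open>a = q\<^sub>1 > b = q\<^sub>2\<close>. Both objectives are a constant minus an expected loss: the probability
  that some demand is left over for SLM, and the expected total leftover demand for EAM. By
  memorylessness the loss depends on a policy only through the recursion
  \<open>H\<^sub>k\<^sub>+\<^sub>1 = \<alpha> A^k a^x (1 - b^y) + \<beta> B^k (1 - a^x) b^y + a^x b^y H\<^sub>k\<close>
  with \<open>A = a^C\<close>, \<open>B = b^C\<close> and \<open>x + y = C\<close>. Here \<open>\<alpha>, \<beta>, H\<^sub>0\<close> are \<open>1, 1, 1\<close> for SLM and
  \<open>1/(1-a), 1/(1-b), \<alpha> + \<beta>\<close> for EAM; the proof only uses \<open>\<alpha> \<ge> \<beta> > 0\<close> and the identity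
  \<open>(a - b) (\<alpha> + \<beta> - H\<^sub>0) = (1 - b) \<beta> - (1 - a) \<alpha>\<close>, shared by both.

  The increment of the right-hand side in \<open>x\<close> has the sign of a quantity \<open>\<psi>\<^sub>k(x)\<close> that increases
  with \<open>x\<close>, so the least \<open>x\<close> with \<open>\<psi>\<^sub>k(x) \<ge> 0\<close> is optimal. The inequality
  \<open>\<psi>\<^sub>k\<^sub>+\<^sub>1(x) \<le> a^x b^y \<psi>\<^sub>k(x)\<close> makes it non-decreasing in \<open>k\<close>, an invariant of
  \<open>D\<^sub>k = \<alpha> A^k + \<beta> B^k - H\<^sub>k\<close> gives \<open>\<psi>\<^sub>k(C - 1) \<ge> 0\<close>, the case \<open>k = 0\<close> gives \<open>x \<ge> y\<close>, and a
  lower bound on \<open>D\<^sub>k\<close> shows \<open>\<psi>\<^sub>k(C - 2) < 0\<close> for large \<open>k\<close>.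
\<close>

section \<open>Power inequalities\<close>

text \<open>For \<open>b < a\<close>, division by \<open>(a - b) * (1 - b)\<close> leaves the sum of
  \<open>a ^ i * b ^ (n - 1 - i)\<close> on the left and that of the \<open>b ^ (n - 1 - i)\<close>
  on the right; compare term by term.\<close>

lemma power_diff_le:
  fixes a b :: real
  assumes "0 \<le> b" "b \<le> a" "a \<le> 1"
  shows "(1 - b) * (a ^ n - b ^ n) \<le> (a - b) * (1 - b ^ n)"
proof (induction n)
  case (Suc n)
  have "(1 - b) * (a ^ Suc n - b ^ Suc n) = a ^ n * ((1 - b) * (a - b)) + b * ((1 - b) * (a ^ n - b ^ n))"
    by (simp add: algebra_simps)
  also have "\<dots> \<le> 1 * ((1 - b) * (a - b)) + b * ((a - b) * (1 - b ^ n))"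
    using assms Suc.IH by (intro add_mono mult_left_mono mult_right_mono power_le_one) auto
  also have "\<dots> = (a - b) * (1 - b ^ Suc n)"
    by (simp add: algebra_simps)
  finally show ?case .
qed simp

text \<open>The same sum bounded from below, by \<open>a ^ n \<le> a ^ i\<close> in each
  term.\<close>

lemma power_diff_ge_left:
  fixes a b :: real
  assumes "0 \<le> b" "b \<le> a" "a \<le> 1"
  shows "(a - b) * (a ^ n * (1 - b ^ n)) \<le> (1 - b) * (a ^ n - b ^ n)"
proof (induction n)
  case (Suc n)
  have "(a - b) * (a ^ Suc n * (1 - b ^ Suc n)) =
      a * ((a - b) * (a ^ n * (1 - b ^ n))) + a ^ Suc n * ((1 - b) * (a - b) * b ^ n)"
    by (simp add: algebra_simps)
  also have "\<dots> \<le> a * ((1 - b) * (a ^ n - b ^ n)) + 1 * ((1 - b) * (a - b) * b ^ n)"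
    using assms Suc.IH by (intro add_mono mult_left_mono mult_right_mono power_le_one) auto
  also have "\<dots> = (1 - b) * (a ^ Suc n - b ^ Suc n)"
    by (simp add: algebra_simps)
  finally show ?case .
qed simp

text \<open>The mirror image: the power of \<open>b\<close> in each term is at least
  \<open>b ^ n\<close>.\<close>

lemma power_diff_ge_right:
  fixes a b :: real
  assumes "0 \<le> b" "b \<le> a" "a \<le> 1"
  shows "(a - b) * (b ^ n * (1 - a ^ Suc n)) \<le> (1 - a) * (a ^ Suc n - b ^ Suc n)"
proof (induction n)
  case (Suc n)
  have "(a - b) * (b ^ Suc n * (1 - a ^ Suc (Suc n))) =
      b * ((a - b) * (b ^ n * (1 - a ^ Suc n))) + b ^ Suc n * ((1 - a) * (a - b) * a ^ Suc n)"
    by (simp add: algebra_simps)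
  also have "\<dots> \<le> b * ((1 - a) * (a ^ Suc n - b ^ Suc n)) + 1 * ((1 - a) * (a - b) * a ^ Suc n)"
    using assms Suc.IH by (intro add_mono mult_left_mono mult_right_mono power_le_one) auto
  also have "\<dots> = (1 - a) * (a ^ Suc (Suc n) - b ^ Suc (Suc n))"
    by (simp add: algebra_simps)
  finally show ?case .
qed (simp add: algebra_simps)

text \<open>Division by \<open>(1 - a) * (1 - b)\<close> turns the sides into the sums of
  \<open>(1 / a) ^ j\<close> and \<open>(1 / b) ^ j\<close> over
  \<open>1 \<le> j \<le> n\<close>.\<close>

lemma inverse_power_diff_less:
  fixes a b :: real
  assumes "0 < b" "b < a" "a < 1" "0 < n"
  shows "(1 - b) * ((1 / a) ^ n - 1) < (1 - a) * ((1 / b) ^ n - 1)"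
  using assms(4)
proof (induction n rule: nat_induct_non_zero)
  case 1
  have "(1 - b) * (1 / a - 1) = (1 - a) * (1 - b) * (1 / a)"
    using assms by (simp add: field_simps)
  also have "\<dots> < (1 - a) * (1 - b) * (1 / b)"
    using assms by (intro mult_strict_left_mono divide_strict_left_mono) auto
  also have "\<dots> = (1 - a) * (1 / b - 1)"
    using assms by (simp add: field_simps)
  finally show ?case by simp
next
  case (Suc n)
  have "(1 - b) * ((1 / a) ^ Suc n - 1) =
      (1 - b) * ((1 / a) ^ n - 1) + (1 - a) * (1 - b) * ((1 / a) ^ Suc n)"
    using assms by (simp add: field_simps)
  also have "\<dots> < (1 - a) * ((1 / b) ^ n - 1) + (1 - a) * (1 - b) * ((1 / b) ^ Suc n)"
    using assms Suc.IH
    by (intro add_less_le_mono mult_left_mono power_mono divide_left_mono) auto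
  also have "\<dots> = (1 - a) * ((1 / b) ^ Suc n - 1)"
    using assms by (simp add: field_simps)
  finally show ?case .
qed

section \<open>The loss recursion\<close>

text \<open>\<open>\<kappa>\<close> is the loss when no rounds are left and both threats are active.
  Its equation makes \<open>defect_le\<close> an equality at \<open>k = 0\<close>, which starts that
  induction.\<close>

locale two_threats =
  fixes a b \<alpha> \<beta> \<kappa> :: real and C :: nat
  assumes b_pos: "0 < b" and b_less_a: "b < a" and a_less_1: "a < 1"
    and C_ge_2: "2 \<le> C"
    and \<beta>_pos: "0 < \<beta>" and \<beta>_le_\<alpha>: "\<beta> \<le> \<alpha>"
    and \<kappa>: "(a - b) * (\<alpha> + \<beta> - \<kappa>) = (1 - b) * \<beta> - (1 - a) * \<alpha>"
begin

lemma a_pos: "0 < a" and b_less_1: "b < 1" and \<alpha>_pos: "0 < \<alpha>"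
  using b_pos b_less_a a_less_1 \<beta>_pos \<beta>_le_\<alpha> by auto

text \<open>
  Expected loss when \<open>x\<close> effectors go to the first of two active threats, with \<open>k\<close> rounds left
  afterwards and expected loss \<open>h\<close> if both threats survive.
\<close>

definition loss :: "nat \<Rightarrow> real \<Rightarrow> nat \<Rightarrow> real" where
  "loss k h x = \<alpha> * (a ^ C) ^ k * a ^ x * (1 - b ^ (C - x)) +
     \<beta> * (b ^ C) ^ k * (1 - a ^ x) * b ^ (C - x) + a ^ x * b ^ (C - x) * h"

primrec opt_loss :: "nat \<Rightarrow> real" where
  "opt_loss 0 = \<kappa>"
| "opt_loss (Suc k) = Min (loss k (opt_loss k) ` {..C})"

text \<open>
  \<open>\<alpha> (a ^ C) ^ k\<close> and \<open>\<beta> (b ^ C) ^ k\<close> are the losses of the threats if each of them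
  were given all \<open>C\<close> effectors in each of \<open>k\<close> rounds.
\<close>

definition defect :: "nat \<Rightarrow> real" where
  "defect k = \<alpha> * (a ^ C) ^ k + \<beta> * (b ^ C) ^ k - opt_loss k"

text \<open>The forward difference of the loss with the positive factor
  \<open>a ^ x * b ^ (C - Suc x)\<close> divided out. After this division \<open>opt_loss\<close>
  enters only through a term free of \<open>x\<close>.\<close>

definition slope :: "nat \<Rightarrow> nat \<Rightarrow> real" where
  "slope k x = (1 - b) * \<beta> * (b ^ C) ^ k * (1 / a) ^ x -
     (1 - a) * \<alpha> * (a ^ C) ^ k * (1 / b) ^ (C - Suc x) - (a - b) * defect k"

text \<open>Taking the least candidate resolves ties the same way at every horizon. \<open>k\<close>
  counts the rounds after the current one.\<close>

definition opt_alloc :: "nat \<Rightarrow> nat" where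
  "opt_alloc k = (LEAST x. 0 \<le> slope k x)"

section \<open>Behaviour of the slope in the allocation and in the horizon\<close>

lemma loss_Suc_diff:
  assumes "x < C"
  shows "loss k (opt_loss k) (Suc x) - loss k (opt_loss k) x = a ^ x * b ^ (C - Suc x) * slope k x"
proof -
  obtain m where m: "C - x = Suc m" "C - Suc x = m"
    using assms by (metis Suc_diff_Suc)
  have "(1 / a) ^ x * a ^ x = 1" "(1 / b) ^ m * b ^ m = 1"
    using a_pos b_pos by (simp_all flip: power_mult_distrib)
  moreover have "a ^ x * b ^ m * slope k x =
     (1 - b) * \<beta> * (b ^ C) ^ k * ((1 / a) ^ x * a ^ x) * b ^ m -
     (1 - a) * \<alpha> * (a ^ C) ^ k * ((1 / b) ^ m * b ^ m) * a ^ x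
     - (a - b) * a ^ x * b ^ m * defect k"
    unfolding slope_def m by (simp only: algebra_simps)
  ultimately show ?thesis
    unfolding m loss_def defect_def by (simp add: algebra_simps)
qed

lemma slope_mono:
  assumes "x \<le> z"
  shows "slope k x \<le> slope k z"
proof -
  have "(1 / a) ^ x \<le> (1 / a) ^ z"
    using assms a_pos a_less_1 by (intro power_increasing) auto
  moreover have "(1 / b) ^ (C - Suc z) \<le> (1 / b) ^ (C - Suc x)"
    using assms b_pos b_less_1 by (intro power_increasing) auto
  ultimately show ?thesis
    unfolding slope_def using a_pos b_pos a_less_1 b_less_1 \<alpha>_pos \<beta>_pos
    by (intro diff_mono mult_left_mono order.refl) auto
qed

lemma opt_loss_Suc_le: "x \<le> C \<Longrightarrow> opt_loss (Suc k) \<le> loss k (opt_loss k) x"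
  by (auto intro!: Min_le)

text \<open>Passing from the loss to the defect absorbs the mixed terms into \<open>defect k\<close>
  and leaves the \<open>\<alpha>\<close> and \<open>\<beta>\<close> parts separate.\<close>

lemma defect_Suc_ge:
  assumes "x \<le> C"
  shows "\<alpha> * (a ^ C) ^ k * (a ^ C - a ^ x) + \<beta> * (b ^ C) ^ k * (b ^ C - b ^ (C - x)) +
    a ^ x * b ^ (C - x) * defect k \<le> defect (Suc k)"
  using opt_loss_Suc_le[OF assms, of k] unfolding defect_def loss_def
  by (simp add: algebra_simps del: opt_loss.simps)

text \<open>Bounding \<open>defect (Suc k)\<close> from below by means of the same allocation
  \<open>x\<close> makes the \<open>defect k\<close> terms cancel. The rest splits into a
  \<open>\<beta>\<close> and an \<open>\<alpha>\<close> part, nonpositive by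
  \<open>power_diff_ge_left\<close> and \<open>power_diff_ge_right\<close>.\<close>

lemma slope_Suc_le:
  assumes "x < C"
  shows "slope (Suc k) x \<le> a ^ x * b ^ (C - x) * slope k x"
proof -
  define m where "m = C - Suc x"
  have C: "C = x + Suc m" and Cx: "C - x = Suc m"
    using assms by (auto simp: m_def)
  let ?w = "(1 / a) ^ x" and ?u = "(1 / b) ^ m"
  have w: "?w * a ^ x = 1" and u: "?u * b ^ m = 1"
    using a_pos b_pos by (simp_all flip: power_mult_distrib)
  have bC: "b ^ C = b ^ x * b ^ Suc m" and aC: "a ^ C = a ^ x * a ^ Suc m"
    by (simp_all add: C power_add)
  have "?w * b ^ Suc m * ((a - b) * (a ^ x * (1 - b ^ x))) \<le> ?w * b ^ Suc m * ((1 - b) * (a ^ x - b ^ x))"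
    using power_diff_ge_left[of b a x] b_pos b_less_a a_less_1 a_pos by (intro mult_left_mono) auto
  also have "\<dots> = (1 - b) * b ^ Suc m * (?w * a ^ x) - (1 - b) * ?w * b ^ C"
    by (simp only: bC algebra_simps)
  also have "?w * b ^ Suc m * ((a - b) * (a ^ x * (1 - b ^ x))) =
      (?w * a ^ x) * ((a - b) * (b ^ Suc m - b ^ C))"
    by (simp only: bC algebra_simps)
  finally have \<beta>: "(1 - b) * (b ^ C * ?w - b ^ Suc m) - (a - b) * (b ^ C - b ^ Suc m) \<le> 0"
    unfolding w by (simp add: algebra_simps)
  have "?u * a ^ x * ((a - b) * (b ^ m * (1 - a ^ Suc m))) \<le>
      ?u * a ^ x * ((1 - a) * (a ^ Suc m - b ^ Suc m))"
    using power_diff_ge_right[of b a m] b_pos b_less_a a_less_1 a_pos by (intro mult_left_mono) auto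
  also have "?u * a ^ x * ((a - b) * (b ^ m * (1 - a ^ Suc m))) = (?u * b ^ m) * ((a - b) * (a ^ x - a ^ C))"
    by (simp only: aC algebra_simps)
  also have "?u * a ^ x * ((1 - a) * (a ^ Suc m - b ^ Suc m)) =
      (1 - a) * (?u * a ^ C) - (1 - a) * a ^ x * b * (?u * b ^ m)"
    by (simp only: aC algebra_simps power_Suc)
  finally have \<alpha>: "(1 - a) * (a ^ x * b - a ^ C * ?u) - (a - b) * (a ^ C - a ^ x) \<le> 0"
    unfolding u by (simp add: algebra_simps)
  have "slope (Suc k) x - a ^ x * b ^ Suc m * slope k x \<le>
      slope (Suc k) x + (a - b) * (defect (Suc k) -
       (\<alpha> * (a ^ C) ^ k * (a ^ C - a ^ x) + \<beta> * (b ^ C) ^ k * (b ^ C - b ^ Suc m) +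
    a ^ x * b ^ Suc m * defect k)) - a ^ x * b ^ Suc m * slope k x"
    using defect_Suc_ge[of x k] assms b_less_a Cx by auto
  also have "\<dots> = \<beta> * (b ^ C) ^ k * ((1 - b) * (b ^ C * ?w - (?w * a ^ x) * b ^ Suc m) - (a - b) * (b ^ C - b ^ Suc m)) +
      \<alpha> * (a ^ C) ^ k * ((1 - a) * (a ^ x * b * (?u * b ^ m) - a ^ C * ?u) - (a - b) * (a ^ C - a ^ x))"
    unfolding slope_def m_def[symmetric] by (simp only: algebra_simps power_Suc)
  also have "\<dots> \<le> 0"
    using \<alpha> \<beta> \<alpha>_pos \<beta>_pos a_pos b_pos unfolding w u
    by (intro add_nonpos_nonpos mult_nonneg_nonpos) auto
  finally show ?thesis
    unfolding Cx by simp
qed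

text \<open>In the induction step the excess splits into a \<open>\<beta>\<close> and an
  \<open>\<alpha>\<close> part, handled by \<open>power_diff_le\<close> with exponents
  \<open>x\<close> and \<open>C - x\<close>.\<close>

lemma defect_le: "(a - b) * defect k \<le> (1 - b) * \<beta> * (b ^ C) ^ k - (1 - a) * \<alpha> * (a ^ C) ^ k"
proof (induction k)
  case 0
  then show ?case using \<kappa> by (simp add: defect_def)
next
  case (Suc k)
  \<comment> \<open>An upper bound on the defect needs an allocation that attains the minimum; lower
    bounds follow from any allocation.\<close>
  have "opt_loss (Suc k) \<in> loss k (opt_loss k) ` {..C}"
    by (simp add: Min_in)
  then obtain x where x: "x \<le> C" "opt_loss (Suc k) = loss k (opt_loss k) x"
    by blast
  define y where "y = C - x"
  have aC: "a ^ C = a ^ x * a ^ y" and bC: "b ^ C = b ^ x * b ^ y"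
    using x(1) by (simp_all add: y_def flip: power_add)
  have D: "defect (Suc k) = \<alpha> * (a ^ C) ^ k * (a ^ C - a ^ x) +
      \<beta> * (b ^ C) ^ k * (b ^ C - b ^ y) + a ^ x * b ^ y * defect k"
    unfolding defect_def x(2) loss_def y_def by (simp add: algebra_simps)
  have "a ^ x * b ^ y * ((a - b) * defect k) \<le>
      a ^ x * b ^ y * ((1 - b) * \<beta> * (b ^ C) ^ k - (1 - a) * \<alpha> * (a ^ C) ^ k)"
    using Suc.IH a_pos b_pos by (intro mult_left_mono) auto
  then have "(a - b) * defect (Suc k) - ((1 - b) * \<beta> * (b ^ C) ^ Suc k - (1 - a) * \<alpha> * (a ^ C) ^ Suc k)
    \<le> (a - b) * (\<alpha> * (a ^ C) ^ k * (a ^ C - a ^ x) + \<beta> * (b ^ C) ^ k * (b ^ C - b ^ y)) +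
      a ^ x * b ^ y * ((1 - b) * \<beta> * (b ^ C) ^ k - (1 - a) * \<alpha> * (a ^ C) ^ k)
      - ((1 - b) * \<beta> * (b ^ C) ^ Suc k - (1 - a) * \<alpha> * (a ^ C) ^ Suc k)"
    unfolding D by (simp add: algebra_simps)
  also have "\<dots> = \<beta> * (b ^ C) ^ k * b ^ y * ((1 - b) * (a ^ x - b ^ x) - (a - b) * (1 - b ^ x)) +
      \<alpha> * (a ^ C) ^ k * a ^ x * ((1 - b) * (a ^ y - b ^ y) - (a - b) * (1 - b ^ y))"
    unfolding power_Suc by (simp add: aC bC algebra_simps)
  also have "\<dots> \<le> 0"
    using power_diff_le[of b a x] power_diff_le[of b a y] \<alpha>_pos \<beta>_pos a_pos b_pos b_less_a a_less_1
    by (intro add_nonpos_nonpos mult_nonneg_nonpos) auto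
  finally show ?case by simp
qed

text \<open>At \<open>C - 1\<close> the power of \<open>1 / b\<close> is 1 and that of
  \<open>1 / a\<close> is at least 1, so \<open>defect_le\<close> applies.\<close>

lemma slope_last_nonneg: "0 \<le> slope k (C - 1)"
proof -
  have "1 \<le> (1 / a) ^ (C - 1)"
    using a_pos a_less_1 by (intro one_le_power) auto
  then have "(1 - b) * \<beta> * (b ^ C) ^ k * 1 \<le> (1 - b) * \<beta> * (b ^ C) ^ k * (1 / a) ^ (C - 1)"
    using b_less_1 b_pos \<beta>_pos by (intro mult_left_mono) auto
  then show ?thesis
    using defect_le[of k] C_ge_2 by (simp add: slope_def)
qed

section \<open>The optimal allocation\<close>

lemma opt_alloc_less: "opt_alloc k < C"
  using Least_le[of "\<lambda>x. 0 \<le> slope k x", OF slope_last_nonneg] C_ge_2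
  unfolding opt_alloc_def by linarith

lemma slope_opt_alloc: "0 \<le> slope k (opt_alloc k)"
  unfolding opt_alloc_def by (rule LeastI[of "\<lambda>x. 0 \<le> slope k x"], rule slope_last_nonneg)

text \<open>The slope is negative before \<open>opt_alloc k\<close> and nonnegative from there on,
  so the loss falls up to this point and never falls after it.\<close>

lemma opt_loss_Suc: "opt_loss (Suc k) = loss k (opt_loss k) (opt_alloc k)"
proof -
  let ?\<phi> = "loss k (opt_loss k)" and ?x = "opt_alloc k"
  have up: "?\<phi> ?x \<le> ?\<phi> z" if "?x \<le> z" "z \<le> C" for z
    using that
  proof (induction z rule: dec_induct)
    case (step z)
    have "0 \<le> a ^ z * b ^ (C - Suc z) * slope k z"
      using order_trans[OF slope_opt_alloc slope_mono[OF step(1)]] a_pos b_pos by simp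
    then show ?case using step loss_Suc_diff[of z k] by simp
  qed simp
  have down: "?\<phi> ?x \<le> ?\<phi> z" if "z \<le> ?x" for z
    using that
  proof (induction z rule: inc_induct)
    case (step z)
    have "slope k z < 0"
      using not_less_Least[of z "\<lambda>x. 0 \<le> slope k x"] step(2) by (simp add: opt_alloc_def)
    then have "a ^ z * b ^ (C - Suc z) * slope k z \<le> 0"
      using a_pos b_pos by (intro mult_nonneg_nonpos) auto
    then show ?case using step loss_Suc_diff[of z k] opt_alloc_less[of k] by simp
  qed simp
  have "Min (?\<phi> ` {..C}) = ?\<phi> ?x"
    using up down opt_alloc_less[of k] by (intro Min_eqI) (auto, meson nat_le_linear)
  then show ?thesis by simp
qed

text \<open>By \<open>slope_Suc_le\<close>, an \<open>x < C\<close> with nonnegative slope at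
  horizon \<open>Suc k\<close> also has one at horizon \<open>k\<close>.\<close>

lemma opt_alloc_mono: "mono opt_alloc"
proof (rule monoI, erule lift_Suc_mono_le[rotated])
  fix k
  let ?x = "opt_alloc (Suc k)"
  have "0 \<le> a ^ ?x * b ^ (C - ?x) * slope k ?x"
    using slope_Suc_le[of ?x k] opt_alloc_less[of "Suc k"] slope_opt_alloc[of "Suc k"] by simp
  moreover have "0 < a ^ ?x * b ^ (C - ?x)"
    using a_pos b_pos by simp
  ultimately have "0 \<le> slope k ?x"
    by (meson mult_pos_neg not_le)
  then show "opt_alloc k \<le> ?x"
    unfolding opt_alloc_def[of k] by (rule Least_le)
qed

text \<open>By monotonicity \<open>k = 0\<close> suffices. There the equation for
  \<open>\<kappa>\<close> reduces the slope to \<open>(1 - b) * \<beta> * ((1 / a) ^ x - 1) - (1 -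
  a) * \<alpha> * ((1 / b) ^ m - 1)\<close>.\<close>

lemma opt_alloc_ge_half: "C - opt_alloc k \<le> opt_alloc k"
proof -
  have "slope 0 x < 0" if x: "2 * x < C" for x
  proof -
    define m where "m = C - Suc x"
    have m: "x \<le> m" "0 < m"
      using x C_ge_2 by (auto simp: m_def)
    have "(1 / a) ^ x \<le> (1 / a) ^ m"
      using m a_pos a_less_1 by (intro power_increasing) auto
    then have "(1 - b) * ((1 / a) ^ x - 1) \<le> (1 - b) * ((1 / a) ^ m - 1)"
      using b_less_1 by simp
    also have "\<dots> < (1 - a) * ((1 / b) ^ m - 1)"
      using inverse_power_diff_less b_pos b_less_a a_less_1 m by blast
    finally have "\<beta> * ((1 - b) * ((1 / a) ^ x - 1)) < \<beta> * ((1 - a) * ((1 / b) ^ m - 1))"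
      using \<beta>_pos by simp
    also have "\<dots> \<le> \<alpha> * ((1 - a) * ((1 / b) ^ m - 1))"
      using \<beta>_le_\<alpha> a_less_1 b_pos b_less_1 one_le_power[of "1 / b" m]
      by (intro mult_right_mono) auto
    finally show ?thesis
      unfolding slope_def defect_def m_def[symmetric] using \<kappa> by (simp add: algebra_simps)
  qed
  then have "C \<le> 2 * opt_alloc 0"
    using slope_opt_alloc[of 0] by (meson not_le)
  also have "opt_alloc 0 \<le> opt_alloc k"
    using opt_alloc_mono by (simp add: monoD)
  finally show ?thesis by simp
qed

text \<open>
  The left-hand side solves the recursion in which every round allocates \<open>(C - 1, 1)\<close>.
\<close>

lemma defect_ge:
  obtains \<eta> K where "\<And>k. - (\<alpha> * (1 - a)) / (a - b) * (a ^ C) ^ k + \<eta> * (b ^ C) ^ k - K * (a ^ (C - 1) * b) ^ k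
    \<le> defect k"
proof -
  define w where "w = a ^ (C - 1) * b"
  \<comment> \<open>Undetermined coefficients: \<open>- P\<close> and \<open>\<eta>\<close> fit the
    source terms with bases \<open>a ^ C\<close> and \<open>b ^ C\<close>, \<open>w\<close> is the
    homogeneous ratio, and \<open>K\<close> fits the value at \<open>k = 0\<close>.\<close>
  define P where "P = \<alpha> * (1 - a) / (a - b)"
  define \<eta> where "\<eta> = \<beta> * (b - b ^ C) / (w - b ^ C)"
  define K where "K = - P + \<eta> - defect 0"
  have aC: "a ^ C = a * a ^ (C - 1)" and bC: "b ^ C = b * b ^ (C - 1)"
    using C_ge_2 by (simp_all flip: power_Suc)
  have "b ^ (C - 1) < a ^ (C - 1)"
    using C_ge_2 b_less_a b_pos by (intro power_strict_mono) auto
  then have "b ^ C < w"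
    using b_pos by (simp add: bC w_def)
  then have \<eta>: "\<eta> * w - \<eta> * b ^ C = \<beta> * (b - b ^ C)"
    unfolding right_diff_distrib[of \<eta>, symmetric] by (simp add: \<eta>_def)
  have P: "P * a - P * b = \<alpha> * (1 - a)"
    unfolding right_diff_distrib[of P, symmetric] using b_less_a by (simp add: P_def)
  have "- P * (a ^ C) ^ k + \<eta> * (b ^ C) ^ k - K * w ^ k \<le> defect k" for k
  proof (induction k)
    case (Suc k)
    have "- P * (a ^ C) ^ Suc k + \<eta> * (b ^ C) ^ Suc k - K * w ^ Suc k =
      - (P * a) * (a ^ C) ^ k * a ^ (C - 1) + \<eta> * b ^ C * (b ^ C) ^ k - K * w ^ Suc k"
      by (simp add: aC)
    also have "\<dots> = - (\<alpha> * (1 - a)) * (a ^ C) ^ k * a ^ (C - 1) - \<beta> * (b - b ^ C) * (b ^ C) ^ k +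
      w * (- P * (a ^ C) ^ k + \<eta> * (b ^ C) ^ k - K * w ^ k)"
      unfolding P[symmetric] \<eta>[symmetric] by (simp add: w_def algebra_simps)
    also have "\<dots> \<le> - (\<alpha> * (1 - a)) * (a ^ C) ^ k * a ^ (C - 1) - \<beta> * (b - b ^ C) * (b ^ C) ^ k +
      w * defect k"
      using Suc.IH a_pos b_pos by (intro add_left_mono mult_left_mono) (auto simp: w_def)
    also have "\<dots> = \<alpha> * (a ^ C) ^ k * (a ^ C - a ^ (C - 1)) + \<beta> * (b ^ C) ^ k * (b ^ C - b ^ (C - (C - 1))) +
      a ^ (C - 1) * b ^ (C - (C - 1)) * defect k"
      using C_ge_2 by (simp add: w_def aC algebra_simps)
    also have "\<dots> \<le> defect (Suc k)"
      by (rule defect_Suc_ge) simp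
    finally show ?case .
  qed (simp add: K_def)
  then show ?thesis
    by (intro that[of \<eta> K]) (simp add: P_def w_def)
qed

text \<open>After division by the dominant \<open>(a ^ C) ^ k\<close>, the upper bound on the slope
  at \<open>C - 2\<close> tends to \<open>(1 - a) * \<alpha> * (1 - 1 / b)\<close>, which is
  negative.\<close>

lemma opt_alloc_eventually: "\<forall>\<^sub>F k in sequentially. opt_alloc k = C - 1"
proof -
  obtain \<eta> K where D: "\<And>k. - (\<alpha> * (1 - a)) / (a - b) * (a ^ C) ^ k + \<eta> * (b ^ C) ^ k -
      K * (a ^ (C - 1) * b) ^ k \<le> defect k"
    using defect_ge by blast
  define s where "s = (b / a) ^ C"
  define t where "t = b / a"
  have st: "\<bar>s\<bar> < 1" "\<bar>t\<bar> < 1"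
    using a_pos b_pos b_less_a C_ge_2 by (auto simp: s_def t_def power_less_one_iff)
  have aC: "a ^ C = a * a ^ (C - 1)"
    using C_ge_2 by (simp flip: power_Suc)
  have s: "b ^ C = s * a ^ C" and t: "a ^ (C - 1) * b = t * a ^ C"
    using a_pos by (simp_all add: s_def t_def aC power_divide)
  have "(\<lambda>k. (1 - b) * \<beta> * (1 / a) ^ (C - 2) * s ^ k - (1 - a) * \<alpha> * (1 / b)
      + \<alpha> * (1 - a) - (a - b) * \<eta> * s ^ k + (a - b) * K * t ^ k)
    \<longlonglongrightarrow> (1 - b) * \<beta> * (1 / a) ^ (C - 2) * 0 - (1 - a) * \<alpha> * (1 / b)
      + \<alpha> * (1 - a) - (a - b) * \<eta> * 0 + (a - b) * K * 0"
    using st by (intro tendsto_intros LIMSEQ_power_zero) auto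
  moreover have "(1 - a) * \<alpha> * 1 < (1 - a) * \<alpha> * (1 / b)"
    using a_less_1 \<alpha>_pos b_pos b_less_1 by (intro mult_strict_left_mono) auto
  ultimately have "\<forall>\<^sub>F k in sequentially. (1 - b) * \<beta> * (1 / a) ^ (C - 2) * s ^ k - (1 - a) * \<alpha> * (1 / b)
      + \<alpha> * (1 - a) - (a - b) * \<eta> * s ^ k + (a - b) * K * t ^ k < 0"
    by (intro order_tendstoD(2)) (auto simp: algebra_simps)
  then show ?thesis
  proof (eventually_elim)
    case (elim k)
    let ?E = "(1 - b) * \<beta> * (1 / a) ^ (C - 2) * s ^ k - (1 - a) * \<alpha> * (1 / b)
      + \<alpha> * (1 - a) - (a - b) * \<eta> * s ^ k + (a - b) * K * t ^ k"
    have "(a - b) * (- (\<alpha> * (1 - a)) / (a - b) * (a ^ C) ^ k + \<eta> * (b ^ C) ^ k - K * (a ^ (C - 1) * b) ^ k)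
        \<le> (a - b) * defect k"
      using D b_less_a by (intro mult_left_mono) auto
    moreover have "(a - b) * (- (\<alpha> * (1 - a)) / (a - b)) = - (\<alpha> * (1 - a))"
      using b_less_a by simp
    ultimately have "- (\<alpha> * (1 - a)) * (a ^ C) ^ k + (a - b) * \<eta> * (b ^ C) ^ k - (a - b) * K * (a ^ (C - 1) * b) ^ k
        \<le> (a - b) * defect k"
      by (simp only: right_diff_distrib distrib_left mult.assoc[symmetric])
    moreover have "C - Suc (C - 2) = 1"
      using C_ge_2 by simp
    ultimately have "slope k (C - 2) \<le> (a ^ C) ^ k * ?E"
      unfolding slope_def s t power_mult_distrib by (simp add: algebra_simps)
    also have "\<dots> < 0"
      using elim a_pos by (intro mult_pos_neg) auto
    finally have "slope k (C - 2) < 0" .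
    then have "\<not> opt_alloc k \<le> C - 2"
      using slope_opt_alloc[of k] slope_mono[of "opt_alloc k" "C - 2" k] by auto
    then show ?case
      using opt_alloc_less[of k] by auto
  qed
qed

end

section \<open>Memorylessness of the demands\<close>

definition demand :: "real \<Rightarrow> nat pmf" where
  "demand q = map_pmf Suc (geometric_pmf (1 - q))"

lemma demands_2: "map_pmf (\<lambda>L. (L 1, L 2)) (demands 2 q) = pair_pmf (demand (q 1)) (demand (q 2))"
proof -
  have 2: "{1..2} = insert 1 {2::nat}"
    by auto
  have "map_pmf (\<lambda>x. (fst x, snd x 2)) (pair_pmf A B) = pair_pmf A (map_pmf (\<lambda>f. f 2) B)"
    for A :: "nat pmf" and B :: "(nat \<Rightarrow> nat) pmf"
    using map_pair[of id "\<lambda>f. f 2" A B] by (simp add: map_prod_def case_prod_unfold)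
  then show ?thesis
    unfolding demands_def demand_def 2
    by (simp add: Pi_pmf_insert Pi_pmf_singleton pmf.map_comp o_def case_prod_unfold)
qed

text \<open>Memorylessness: with probability \<open>q ^ x\<close> the demand exceeds
  \<open>x\<close> and its excess is again distributed as a demand; otherwise truncated subtraction
  gives 0.\<close>

lemma nn_integral_demand_diff:
  fixes f :: "nat \<Rightarrow> ennreal"
  assumes "0 \<le> q" "q < 1"
  shows "(\<integral>\<^sup>+l. f (l - x) \<partial>demand q) =
    ennreal (q ^ x) * (\<integral>\<^sup>+l. f l \<partial>demand q) + ennreal (1 - q ^ x) * f 0"
proof (induction x arbitrary: f)
  case (Suc x)
  \<comment> \<open>One effector leaves an unshifted geometric variable: 0 with probability
    \<open>1 - q\<close>, otherwise a fresh demand.\<close>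
  have "(\<integral>\<^sup>+l. f (l - 1) \<partial>demand q) = (\<integral>\<^sup>+l. f l \<partial>geometric_pmf (1 - q))"
    by (simp add: demand_def)
  also have "\<dots> = f 0 * ennreal (1 - q) + (\<integral>\<^sup>+l. f (Suc l) \<partial>geometric_pmf (1 - q)) * ennreal q"
    using assms by (subst geometric_bind_pmf_unfold) auto
  also have "(\<integral>\<^sup>+l. f (Suc l) \<partial>geometric_pmf (1 - q)) = (\<integral>\<^sup>+l. f l \<partial>demand q)"
    by (simp add: demand_def)
  finally have step: "(\<integral>\<^sup>+l. f (l - 1) \<partial>demand q) = f 0 * ennreal (1 - q) + (\<integral>\<^sup>+l. f l \<partial>demand q) * ennreal q" .
  have qx: "0 \<le> q ^ x" "q ^ x \<le> 1"
    using assms by (auto intro: power_le_one)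
  have eq: "1 - q ^ Suc x = q ^ x * (1 - q) + (1 - q ^ x)"
    by (simp add: algebra_simps)
  have w: "ennreal (1 - q ^ Suc x) = ennreal (q ^ x) * ennreal (1 - q) + ennreal (1 - q ^ x)"
    unfolding eq using assms qx by (simp only: ennreal_mult ennreal_plus diff_ge_0_iff_ge mult_nonneg_nonneg less_imp_le)
  have "(\<integral>\<^sup>+l. f (l - Suc x) \<partial>demand q) = (\<integral>\<^sup>+l. f (l - x - 1) \<partial>demand q)"
    by simp
  also have "\<dots> = ennreal (q ^ x) * (\<integral>\<^sup>+l. f (l - 1) \<partial>demand q) + ennreal (1 - q ^ x) * f (0 - 1)"
    by (rule Suc.IH)
  also have "\<dots> = ennreal (q ^ Suc x) * (\<integral>\<^sup>+l. f l \<partial>demand q) + ennreal (1 - q ^ Suc x) * f 0"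
    unfolding step w using assms qx by (simp add: ennreal_mult algebra_simps)
  finally show ?case .
qed simp

lemma nn_integral_demand_real:
  assumes "0 \<le> q" "q < 1"
  shows "(\<integral>\<^sup>+l. ennreal (real l) \<partial>demand q) = ennreal (1 / (1 - q))"
proof -
  have p: "1 - q \<in> {0<..1}"
    using assms by simp
  have "ennreal (real (Suc l)) = 1 + ennreal (real l)" for l
    unfolding ennreal_1[symmetric] by (subst ennreal_plus[symmetric]) auto
  then have "(\<integral>\<^sup>+l. ennreal (real l) \<partial>demand q) = (\<integral>\<^sup>+l. 1 + ennreal (real l) \<partial>geometric_pmf (1 - q))"
    by (simp add: demand_def del: of_nat_Suc)
  also have "\<dots> = 1 + (\<integral>\<^sup>+l. ennreal (real l) \<partial>geometric_pmf (1 - q))"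
    by (simp add: nn_integral_add)
  also have "(\<integral>\<^sup>+l. ennreal (real l) \<partial>geometric_pmf (1 - q)) = ennreal (q / (1 - q))"
    using integrable_real_geometric_pmf[OF p] expectation_geometric_pmf[OF p]
    by (subst nn_integral_eq_integral) auto
  also have "1 + \<dots> = ennreal (1 / (1 - q))"
    using assms by (simp add: field_simps flip: ennreal_1 ennreal_plus)
  finally show ?thesis .
qed

section \<open>Residual demands\<close>

definition live :: "nat \<times> nat \<Rightarrow> nat set" where
  "live r = {i \<in> {1..2}. 0 < (if i = 1 then fst r else snd r)}"

text \<open>\<open>k\<close> rounds are still to be played and \<open>t\<close> is the next one. The
  policy sees the state only through its live set, so memorylessness can be applied round by
  round.\<close>

primrec residual :: "policy \<Rightarrow> nat \<Rightarrow> nat \<Rightarrow> nat \<times> nat \<Rightarrow> nat \<times> nat" where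
  "residual \<pi> 0 t r = r"
| "residual \<pi> (Suc k) t r =
     residual \<pi> k (Suc t) (fst r - \<pi> t (live r) 1, snd r - \<pi> t (live r) 2)"

definition remaining :: "nat \<Rightarrow> policy \<Rightarrow> (nat \<Rightarrow> nat) \<Rightarrow> nat \<Rightarrow> nat \<Rightarrow> nat" where
  "remaining n \<pi> L t i = L i - (\<Sum>l\<in>{1..t}. alloc n \<pi> L l i)"

text \<open>Cumulative allocations never decrease, so surviving the latest test implies having
  survived all earlier ones.\<close>

lemma active_Suc:
  assumes "\<And>i. i \<in> {1..n} \<Longrightarrow> 0 < L i"
  shows "active n \<pi> L (Suc t) = {i \<in> {1..n}. 0 < remaining n \<pi> L t i}"
proof (induction t)
  case 0
  then show ?case using assms by (auto simp: remaining_def)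
next
  case (Suc t)
  have "(\<Sum>l\<in>{1..t}. alloc n \<pi> L l i) \<le> (\<Sum>l\<in>{1..Suc t}. alloc n \<pi> L l i)" for i
    by simp
  then show ?case
    unfolding active.simps(3) Suc.IH remaining_def alloc_def[symmetric]
    by (auto simp del: sum.cl_ivl_Suc intro: le_less_trans)
qed

lemma residual_remaining:
  assumes "0 < L 1" "0 < L 2"
  shows "residual \<pi> k (Suc t) (remaining 2 \<pi> L t 1, remaining 2 \<pi> L t 2) =
    (remaining 2 \<pi> L (t + k) 1, remaining 2 \<pi> L (t + k) 2)"
proof (induction k arbitrary: t)
  case (Suc k)
  have "0 < L i" if "i \<in> {1..2}" for i
  proof -
    have "i = 1 \<or> i = 2" using that by auto
    then show ?thesis using assms by auto
  qed
  then have "live (remaining 2 \<pi> L t 1, remaining 2 \<pi> L t 2) = active 2 \<pi> L (Suc t)"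
    by (subst active_Suc) (auto simp: live_def numeral_2_eq_2 le_Suc_eq)
  moreover have "remaining 2 \<pi> L (Suc t) i = remaining 2 \<pi> L t i - \<pi> (Suc t) (active 2 \<pi> L (Suc t)) i" for i
    by (simp add: remaining_def alloc_def)
  ultimately show ?case
    using Suc.IH[of "Suc t"] by simp
qed simp

section \<open>The two objectives in terms of leftover demand\<close>

lemma clear_time_le_iff:
  assumes "1 \<le> \<tau>"
  shows "clear_time n \<pi> L \<le> enat \<tau> \<longleftrightarrow> (\<forall>i\<in>{1..n}. remaining n \<pi> L \<tau> i = 0)"
proof
  let ?S = "{t. 1 \<le> t \<and> (\<forall>i\<in>{1..n}. L i \<le> (\<Sum>l\<in>{1..t}. alloc n \<pi> L l i))}"
  assume le: "clear_time n \<pi> L \<le> enat \<tau>"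
  \<comment> \<open>The infimum of the empty set is infinite; over a nonempty set of
    \<open>enat\<close> it is attained.\<close>
  have "?S \<noteq> {}"
  proof
    assume "?S = {}"
    then have "clear_time n \<pi> L = \<infinity>"
      unfolding clear_time_def by (simp only: image_empty Inf_empty top_enat_def)
    then show False using le by simp
  qed
  then have "clear_time n \<pi> L \<in> enat ` ?S"
    unfolding clear_time_def by (metis (lifting) ex_in_conv image_is_empty wellorder_InfI)
  then obtain t where t: "t \<in> ?S" "t \<le> \<tau>"
    using le by auto
  have "L i \<le> (\<Sum>l\<in>{1..\<tau>}. alloc n \<pi> L l i)" if "i \<in> {1..n}" for i
  proof -
    have "L i \<le> (\<Sum>l\<in>{1..t}. alloc n \<pi> L l i)"
      using t that by blast
    also have "\<dots> \<le> (\<Sum>l\<in>{1..\<tau>}. alloc n \<pi> L l i)"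
      using t by (intro sum_mono2) auto
    finally show ?thesis .
  qed
  then show "\<forall>i\<in>{1..n}. remaining n \<pi> L \<tau> i = 0"
    by (simp add: remaining_def)
next
  assume "\<forall>i\<in>{1..n}. remaining n \<pi> L \<tau> i = 0"
  then show "clear_time n \<pi> L \<le> enat \<tau>"
    unfolding clear_time_def using assms by (intro Inf_lower) (auto simp: remaining_def)
qed

lemma AE_demands_2: "AE L in demands 2 q. 0 < L 1 \<and> 0 < L 2"
proof -
  have "AE r in pair_pmf (demand (q 1)) (demand (q 2)). 0 < fst r \<and> 0 < snd r"
    by (auto simp: AE_measure_pmf_iff demand_def)
  then show ?thesis
    unfolding demands_2[symmetric] by (auto simp: AE_measure_pmf_iff)
qed

lemma nn_integral_demands_residual:
  "(\<integral>\<^sup>+L. f (remaining 2 \<pi> L \<tau> 1, remaining 2 \<pi> L \<tau> 2) \<partial>demands 2 q) =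
    (\<integral>\<^sup>+r. f (residual \<pi> \<tau> 1 r) \<partial>pair_pmf (demand (q 1)) (demand (q 2)))"
proof -
  have "(\<integral>\<^sup>+L. f (remaining 2 \<pi> L \<tau> 1, remaining 2 \<pi> L \<tau> 2) \<partial>demands 2 q) =
      (\<integral>\<^sup>+L. f (residual \<pi> \<tau> 1 (L 1, L 2)) \<partial>demands 2 q)"
  proof (rule nn_integral_cong_AE, use AE_demands_2 in eventually_elim)
    case (elim L)
    then show ?case
      using residual_remaining[of L \<pi> \<tau> 0] by (simp add: remaining_def)
  qed
  also have "\<dots> = (\<integral>\<^sup>+r. f (residual \<pi> \<tau> 1 r) \<partial>map_pmf (\<lambda>L. (L 1, L 2)) (demands 2 q))"
    by simp
  finally show ?thesis unfolding demands_2 .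
qed

lemma V_SLM_2:
  assumes "1 \<le> \<tau>" "0 \<le> W"
    and "(\<integral>\<^sup>+r. of_bool (r \<noteq> (0, 0)) \<partial>map_pmf (residual \<pi> \<tau> 1) (pair_pmf (demand (q 1)) (demand (q 2))))
      = ennreal W"
  shows "V_SLM 2 q \<tau> \<pi> = 1 - W"
proof -
  let ?S = "{L. clear_time 2 \<pi> L \<le> enat \<tau>}"
  have iff: "L \<in> - ?S \<longleftrightarrow> (remaining 2 \<pi> L \<tau> 1, remaining 2 \<pi> L \<tau> 2) \<noteq> (0, 0)" for L
    using assms(1) by (simp add: clear_time_le_iff numeral_2_eq_2 atLeastAtMostSuc_conv conj_commute)
  have "emeasure (demands 2 q) (- ?S) = (\<integral>\<^sup>+L. indicator (- ?S) L \<partial>demands 2 q)"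
    by simp
  also have "\<dots> = (\<integral>\<^sup>+L. of_bool ((remaining 2 \<pi> L \<tau> 1, remaining 2 \<pi> L \<tau> 2) \<noteq> (0, 0)) \<partial>demands 2 q)"
    unfolding indicator_def iff ..
  also have "\<dots> = ennreal W"
    using assms(3) by (subst nn_integral_demands_residual) simp
  finally have "measure_pmf.prob (demands 2 q) (- ?S) = W"
    using assms(2) by (simp add: measure_def)
  then show ?thesis
    unfolding V_SLM_def using measure_pmf.prob_compl[of ?S "demands 2 q"]
    by (simp add: Compl_eq_Diff_UNIV)
qed

text \<open>Served plus leftover demand is total demand, whose mean is
  \<open>1 / (1 - q 1) + 1 / (1 - q 2)\<close>.\<close>

lemma V_EAM_2:
  assumes "0 \<le> W" "0 \<le> q 1" "q 1 < 1" "0 \<le> q 2" "q 2 < 1"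
    and W: "(\<integral>\<^sup>+r. ennreal (real (fst r)) + ennreal (real (snd r))
        \<partial>map_pmf (residual \<pi> \<tau> 1) (pair_pmf (demand (q 1)) (demand (q 2)))) = ennreal W"
  shows "V_EAM 2 q \<tau> \<pi> = 1 / (1 - q 1) + 1 / (1 - q 2) - W"
proof -
  let ?N = "\<lambda>L. \<Sum>i\<in>{1..2}. real (min (\<Sum>t\<in>{1..\<tau>}. alloc 2 \<pi> L t i) (L i))"
  let ?R = "\<lambda>L. ennreal (real (remaining 2 \<pi> L \<tau> 1)) + ennreal (real (remaining 2 \<pi> L \<tau> 2))"
  let ?c = "1 / (1 - q 1) + 1 / (1 - q 2)"
  have R: "(\<integral>\<^sup>+L. ?R L \<partial>demands 2 q) = ennreal W"
    using nn_integral_demands_residual[where f = "\<lambda>r. ennreal (real (fst r)) + ennreal (real (snd r))"] W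
    by simp
  have "ennreal (?N L) + ?R L = ennreal (real (L 1)) + ennreal (real (L 2))" for L
  proof -
    have "real (min x l) + real (l - x) = real l" for x l :: nat
      by simp
    then have "?N L + (real (remaining 2 \<pi> L \<tau> 1) + real (remaining 2 \<pi> L \<tau> 2)) = real (L 1) + real (L 2)"
      by (simp add: remaining_def numeral_2_eq_2 del: of_nat_min of_nat_diff)
    then show ?thesis
      by (simp flip: ennreal_plus add: sum_nonneg)
  qed
  then have "(\<integral>\<^sup>+L. ennreal (?N L) \<partial>demands 2 q) + (\<integral>\<^sup>+L. ?R L \<partial>demands 2 q) =
      (\<integral>\<^sup>+L. ennreal (real (L 1)) + ennreal (real (L 2)) \<partial>demands 2 q)"
    by (simp flip: nn_integral_add)
  also have "\<dots> = (\<integral>\<^sup>+r. ennreal (real (fst r)) + ennreal (real (snd r)) \<partial>map_pmf (\<lambda>L. (L 1, L 2)) (demands 2 q))"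
    by simp
  also have "\<dots> = ennreal ?c"
    using assms(2-5) unfolding demands_2 nn_integral_pair_pmf'
    by (simp add: nn_integral_add nn_integral_demand_real ennreal_plus)
  finally have sum: "(\<integral>\<^sup>+L. ennreal (?N L) \<partial>demands 2 q) + ennreal W = ennreal ?c"
    unfolding R .
  \<comment> \<open>This ensures that the truncated subtraction in \<open>ennreal\<close> below
    agrees with the real one.\<close>
  have "ennreal W \<le> ennreal ?c"
    unfolding sum[symmetric] by simp
  then have "W \<le> ?c"
    using assms by (subst (asm) ennreal_le_iff) auto
  have "(\<integral>\<^sup>+L. ennreal (?N L) \<partial>demands 2 q) = ennreal ?c - ennreal W"
    unfolding sum[symmetric] by simp
  then have "(\<integral>\<^sup>+L. ennreal (?N L) \<partial>demands 2 q) = ennreal (?c - W)"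
    using assms(1) by (simp add: ennreal_minus)
  then show ?thesis
    unfolding V_EAM_def using \<open>W \<le> ?c\<close>
    by (intro integral_eq_nn_integral[THEN trans]) (auto simp: sum_nonneg)
qed

section \<open>Rounds with a single active threat\<close>

lemma policies_2D:
  assumes "\<pi> \<in> policies 2 C" "1 \<le> t"
  shows "\<pi> t {1, 2} 1 + \<pi> t {1, 2} 2 = C" "\<pi> t {1} 1 = C" "\<pi> t {2} 2 = C"
proof -
  have *: "(\<Sum>i\<in>M. \<pi> t M i) = C" if "M \<subseteq> {1..2}" "M \<noteq> {}" for M
    using assms that by (auto simp: policies_def)
  show "\<pi> t {1, 2} 1 + \<pi> t {1, 2} 2 = C" "\<pi> t {1} 1 = C" "\<pi> t {2} 2 = C"
    using *[of "{1, 2}"] *[of "{1}"] *[of "{2}"] by auto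
qed

lemma live_simps:
  "live (0, 0) = {}" "0 < m \<Longrightarrow> live (m, 0) = {1}" "0 < n \<Longrightarrow> live (0, n) = {2}"
  "0 < m \<Longrightarrow> 0 < n \<Longrightarrow> live (m, n) = {1, 2}"
  by (auto simp: live_def split: if_splits)

lemma residual_zero [simp]: "residual \<pi> k t (0, 0) = (0, 0)"
  by (induction k arbitrary: t) auto

lemma AE_demand_pos: "AE l in demand q. 0 < l"
  by (auto simp: AE_measure_pmf_iff demand_def)

text \<open>A lone threat must receive all \<open>C\<close> effectors, so every round contributes a
  factor \<open>q ^ C\<close>; the cleared branch vanishes because
  \<open>f (0, 0) = 0\<close>.\<close>

lemma nn_integral_residual_single:
  assumes "0 \<le> q" "q < 1" "\<pi> \<in> policies 2 C" "1 \<le> t" and f: "f (0, 0) = (0 :: ennreal)"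
  shows "(\<integral>\<^sup>+l. f (residual \<pi> k t (l, 0)) \<partial>demand q) = ennreal ((q ^ C) ^ k) * (\<integral>\<^sup>+l. f (l, 0) \<partial>demand q)"
    and "(\<integral>\<^sup>+l. f (residual \<pi> k t (0, l)) \<partial>demand q) = ennreal ((q ^ C) ^ k) * (\<integral>\<^sup>+l. f (0, l) \<partial>demand q)"
  using assms(4)
proof (induction k arbitrary: t)
  case (Suc k)
  note pol = policies_2D[OF assms(3)]
  have mult: "ennreal ((q ^ C) ^ Suc k) = ennreal (q ^ C) * ennreal ((q ^ C) ^ k)"
    using assms by (simp add: ennreal_mult)
  {
    case 1
    have "(\<integral>\<^sup>+l. f (residual \<pi> (Suc k) t (l, 0)) \<partial>demand q) = (\<integral>\<^sup>+l. f (residual \<pi> k (Suc t) (l - C, 0)) \<partial>demand q)"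
      by (rule nn_integral_cong_AE, use AE_demand_pos in eventually_elim) (simp add: live_simps pol[OF 1, simplified])
    also have "\<dots> = ennreal (q ^ C) * (\<integral>\<^sup>+l. f (residual \<pi> k (Suc t) (l, 0)) \<partial>demand q)"
      using assms nn_integral_demand_diff[of q "\<lambda>l. f (residual \<pi> k (Suc t) (l, 0))" C] by simp
    finally show ?case
      using Suc.IH(1)[of "Suc t"] unfolding mult by (simp add: mult.assoc)
  next
    case 2
    have "(\<integral>\<^sup>+l. f (residual \<pi> (Suc k) t (0, l)) \<partial>demand q) = (\<integral>\<^sup>+l. f (residual \<pi> k (Suc t) (0, l - C)) \<partial>demand q)"
      by (rule nn_integral_cong_AE, use AE_demand_pos in eventually_elim) (simp add: live_simps pol[OF 2, simplified])
    also have "\<dots> = ennreal (q ^ C) * (\<integral>\<^sup>+l. f (residual \<pi> k (Suc t) (0, l)) \<partial>demand q)"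
      using assms nn_integral_demand_diff[of q "\<lambda>l. f (residual \<pi> k (Suc t) (0, l))" C] by simp
    finally show ?case
      using Suc.IH(2)[of "Suc t"] unfolding mult by (simp add: mult.assoc)
  }
qed simp_all

section \<open>Optimal policies\<close>

context two_threats
begin

text \<open>Only the allocation at \<open>{1, 2}\<close> enters, since the one for a lone threat is
  forced.\<close>

primrec policy_loss :: "policy \<Rightarrow> nat \<Rightarrow> nat \<Rightarrow> real" where
  "policy_loss \<pi> 0 t = \<kappa>"
| "policy_loss \<pi> (Suc k) t = loss k (policy_loss \<pi> k (Suc t)) (\<pi> t {1, 2} 1)"

lemma loss_nonneg: "0 \<le> h \<Longrightarrow> 0 \<le> loss k h x"
  unfolding loss_def using a_pos b_pos a_less_1 b_less_1 \<alpha>_pos \<beta>_pos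
  by (intro add_nonneg_nonneg mult_nonneg_nonneg) (auto intro: power_le_one)

lemma loss_mono: "h \<le> h' \<Longrightarrow> loss k h x \<le> loss k h' x"
  unfolding loss_def using a_pos b_pos by (intro add_left_mono mult_left_mono) auto

lemma policy_loss_nonneg: "0 \<le> \<kappa> \<Longrightarrow> 0 \<le> policy_loss \<pi> k t"
  by (induction k arbitrary: t) (auto intro: loss_nonneg)

text \<open>\<open>f\<close> is the terminal loss of either objective. Memorylessness in each
  coordinate splits the first round by its set of survivors, which gives the three terms of
  \<open>loss\<close>.\<close>

lemma nn_integral_residual:
  fixes f :: "nat \<times> nat \<Rightarrow> ennreal"
  assumes f: "f (0, 0) = 0" "(\<integral>\<^sup>+l. f (l, 0) \<partial>demand a) = ennreal \<alpha>"
      "(\<integral>\<^sup>+l. f (0, l) \<partial>demand b) = ennreal \<beta>" "(\<integral>\<^sup>+r. f r \<partial>pair_pmf (demand a) (demand b)) = ennreal \<kappa>"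
    and "0 \<le> \<kappa>" "\<pi> \<in> policies 2 C" "1 \<le> t"
  shows "(\<integral>\<^sup>+r. f (residual \<pi> k t r) \<partial>pair_pmf (demand a) (demand b)) = ennreal (policy_loss \<pi> k t)"
  using assms(7)
proof (induction k arbitrary: t)
  case 0
  then show ?case using f(4) by simp
next
  case (Suc k)
  define x where "x = \<pi> t {1, 2} 1"
  define y where "y = C - x"
  have y: "\<pi> t {1, 2} 2 = y"
    using policies_2D(1)[OF assms(6) Suc.prems] by (simp add: x_def y_def)
  let ?g = "\<lambda>r. f (residual \<pi> k (Suc t) r)"
  have a: "0 \<le> a" "a < 1" and b: "0 \<le> b" "b < 1"
    using a_pos b_pos a_less_1 b_less_1 by auto
  have ax: "0 \<le> a ^ x" "a ^ x \<le> 1" and b_y: "0 \<le> b ^ y" "b ^ y \<le> 1"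
    using a b by (auto intro: power_le_one)
  have g1: "(\<integral>\<^sup>+m. ?g (m, 0) \<partial>demand a) = ennreal ((a ^ C) ^ k * \<alpha>)"
    using nn_integral_residual_single(1)[OF a assms(6), of "Suc t" f k] f a \<alpha>_pos by (simp add: ennreal_mult)
  have g2: "(\<integral>\<^sup>+n. ?g (0, n) \<partial>demand b) = ennreal ((b ^ C) ^ k * \<beta>)"
    using nn_integral_residual_single(2)[OF b assms(6), of "Suc t" f k] f b \<beta>_pos by (simp add: ennreal_mult)
  have g: "(\<integral>\<^sup>+m. \<integral>\<^sup>+n. ?g (m, n) \<partial>demand b \<partial>demand a) = ennreal (policy_loss \<pi> k (Suc t))"
    using Suc.IH[of "Suc t"] by (simp add: nn_integral_pair_pmf')
  have W: "0 \<le> policy_loss \<pi> k (Suc t)"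
    using policy_loss_nonneg assms(5) .
  have "(\<integral>\<^sup>+r. f (residual \<pi> (Suc k) t r) \<partial>pair_pmf (demand a) (demand b)) =
      (\<integral>\<^sup>+m. \<integral>\<^sup>+n. f (residual \<pi> (Suc k) t (m, n)) \<partial>demand b \<partial>demand a)"
    by (rule nn_integral_pair_pmf')
  also have "\<dots> = (\<integral>\<^sup>+m. \<integral>\<^sup>+n. ?g (m - x, n - y) \<partial>demand b \<partial>demand a)"
  proof (rule nn_integral_cong_AE, use AE_demand_pos in eventually_elim)
    case (elim m)
    show ?case
      by (rule nn_integral_cong_AE, use AE_demand_pos in eventually_elim)
        (use elim y in \<open>simp add: live_simps x_def\<close>)
  qed
  also have "\<dots> = (\<integral>\<^sup>+m. ennreal (b ^ y) * (\<integral>\<^sup>+n. ?g (m - x, n) \<partial>demand b) + ennreal (1 - b ^ y) * ?g (m - x, 0) \<partial>demand a)"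
    by (intro nn_integral_cong nn_integral_demand_diff[OF b, of "\<lambda>n. ?g (m - x, n)" y for m])
  also have "\<dots> = ennreal (b ^ y) * (\<integral>\<^sup>+m. \<integral>\<^sup>+n. ?g (m - x, n) \<partial>demand b \<partial>demand a) +
      ennreal (1 - b ^ y) * (\<integral>\<^sup>+m. ?g (m - x, 0) \<partial>demand a)"
    by (simp add: nn_integral_add nn_integral_cmult)
  also have "\<dots> = ennreal (b ^ y) * (ennreal (a ^ x) * ennreal (policy_loss \<pi> k (Suc t)) +
        ennreal (1 - a ^ x) * ennreal ((b ^ C) ^ k * \<beta>)) +
      ennreal (1 - b ^ y) * (ennreal (a ^ x) * ennreal ((a ^ C) ^ k * \<alpha>))"
    using nn_integral_demand_diff[OF a, of "\<lambda>m. \<integral>\<^sup>+n. ?g (m, n) \<partial>demand b" x]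
      nn_integral_demand_diff[OF a, of "\<lambda>m. ?g (m, 0)" x] f(1)
    by (simp add: g g1 g2)
  also have "\<dots> = ennreal (b ^ y * (a ^ x * policy_loss \<pi> k (Suc t) + (1 - a ^ x) * ((b ^ C) ^ k * \<beta>)) +
      (1 - b ^ y) * (a ^ x * ((a ^ C) ^ k * \<alpha>)))"
    using ax b_y W a b \<alpha>_pos \<beta>_pos by (simp add: ennreal_mult ennreal_plus)
  also have "b ^ y * (a ^ x * policy_loss \<pi> k (Suc t) + (1 - a ^ x) * ((b ^ C) ^ k * \<beta>)) +
      (1 - b ^ y) * (a ^ x * ((a ^ C) ^ k * \<alpha>)) = policy_loss \<pi> (Suc k) t"
    by (simp add: loss_def x_def y_def algebra_simps)
  finally show ?case .
qed

lemma opt_loss_le_policy_loss: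
  assumes "\<pi> \<in> policies 2 C" "1 \<le> t"
  shows "opt_loss k \<le> policy_loss \<pi> k t"
  using assms(2)
proof (induction k arbitrary: t)
  case (Suc k)
  have "\<pi> t {1, 2} 1 \<le> C"
    using policies_2D(1)[OF assms(1) Suc.prems] by simp
  then have "opt_loss (Suc k) \<le> loss k (opt_loss k) (\<pi> t {1, 2} 1)"
    by (rule opt_loss_Suc_le)
  also have "\<dots> \<le> policy_loss \<pi> (Suc k) t"
    using Suc.IH[of "Suc t"] by (simp add: loss_mono)
  finally show ?case .
qed simp

text \<open>\<open>\<tau> - t\<close> rounds follow round \<open>t\<close>. Past the deadline
  truncated subtraction selects \<open>opt_alloc 0\<close>, which keeps the policy
  admissible.\<close>

definition opt_policy :: "nat \<Rightarrow> policy" where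
  "opt_policy \<tau> t M i =
    (if M = {1, 2} then (if i = 1 then opt_alloc (\<tau> - t) else if i = 2 then C - opt_alloc (\<tau> - t) else 0)
     else if M = {i} then C else 0)"

lemma opt_policy_in_policies: "opt_policy \<tau> \<in> policies 2 C"
proof -
  have "(\<Sum>i\<in>{1..2}. opt_policy \<tau> t M i) \<le> C \<and> (M \<noteq> {} \<longrightarrow> (\<Sum>i\<in>M. opt_policy \<tau> t M i) = C)"
    if "M \<subseteq> {1..2}" for t M
  proof -
    have 2: "{1..2} = {1, 2 :: nat}"
      by auto
    have "M \<in> Pow {1, 2}"
      using that unfolding 2 by simp
    then have "M = {} \<or> M = {1} \<or> M = {2} \<or> M = {1, 2}"
      by (simp add: Pow_insert insert_commute)
    then show ?thesis
      unfolding 2 using opt_alloc_less[of "\<tau> - t"]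
      by (auto simp: opt_policy_def)
  qed
  then show ?thesis by (simp add: policies_def)
qed

text \<open>\<open>Suc \<tau> - k\<close> is the round from which \<open>k\<close> rounds remain,
  itself included.\<close>

lemma policy_loss_opt_policy: "k \<le> \<tau> \<Longrightarrow> policy_loss (opt_policy \<tau>) k (Suc \<tau> - k) = opt_loss k"
proof (induction k)
  case (Suc k)
  then have "Suc (Suc \<tau> - Suc k) = Suc \<tau> - k" "\<tau> - (Suc \<tau> - Suc k) = k"
    by auto
  then show ?case
    using Suc opt_loss_Suc[of k] by (simp add: opt_policy_def)
qed simp

lemma ex_optimal_policy:
  fixes V :: "nat \<Rightarrow> policy \<Rightarrow> real"
  assumes V: "\<And>\<tau> \<pi>. 1 \<le> \<tau> \<Longrightarrow> \<pi> \<in> policies 2 C \<Longrightarrow> V \<tau> \<pi> = c - policy_loss \<pi> \<tau> 1"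
  shows "\<exists>\<pi> :: nat \<Rightarrow> policy.
    (\<forall>\<tau>\<ge>1. optimal_policy 2 C (V \<tau>) (\<pi> \<tau>)) \<and>
    (\<forall>\<^sub>F \<tau> in sequentially. \<pi> \<tau> 1 {1, 2} 1 = C - 1 \<and> \<pi> \<tau> 1 {1, 2} 2 = 1) \<and>
    (\<forall>\<tau>\<ge>1. \<not> (\<pi> \<tau> 1 {1, 2} 1 = C \<and> \<pi> \<tau> 1 {1, 2} 2 = 0)) \<and>
    mono_on {1..} (\<lambda>\<tau>. \<pi> \<tau> 1 {1, 2} 1) \<and>
    antimono_on {1..} (\<lambda>\<tau>. \<pi> \<tau> 1 {1, 2} 2) \<and>
    (\<forall>\<tau>\<ge>1. \<pi> \<tau> 1 {1, 2} 2 \<le> \<pi> \<tau> 1 {1, 2} 1)"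
proof (intro exI[of _ opt_policy] conjI allI impI)
  fix \<tau> :: nat
  assume "1 \<le> \<tau>"
  then show "optimal_policy 2 C (V \<tau>) (opt_policy \<tau>)"
    using opt_loss_le_policy_loss policy_loss_opt_policy[of \<tau> \<tau>]
    by (simp add: optimal_policy_def opt_policy_in_policies V)
next
  have "\<forall>\<^sub>F \<tau> in sequentially. opt_alloc (\<tau> - 1) = C - 1"
    by (subst eventually_sequentially_Suc[symmetric]) (use opt_alloc_eventually in simp)
  then show "\<forall>\<^sub>F \<tau> in sequentially. opt_policy \<tau> 1 {1, 2} 1 = C - 1 \<and> opt_policy \<tau> 1 {1, 2} 2 = 1"
    using C_ge_2 by (auto simp: opt_policy_def elim!: eventually_mono)
next
  have mono: "opt_alloc (\<tau> - 1) \<le> opt_alloc (\<tau>' - 1)" if "\<tau> \<le> \<tau>'" for \<tau> \<tau>'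
    using that by (intro monoD[OF opt_alloc_mono]) simp
  show "mono_on {1..} (\<lambda>\<tau>. opt_policy \<tau> 1 {1, 2} 1)"
    using mono by (auto simp: opt_policy_def intro!: mono_onI)
  show "antimono_on {1..} (\<lambda>\<tau>. opt_policy \<tau> 1 {1, 2} 2)"
    using mono by (auto simp: opt_policy_def intro!: monotone_onI diff_le_mono2)
qed (use opt_alloc_less opt_alloc_ge_half in \<open>auto simp: opt_policy_def nat_neq_iff\<close>)

end

theorem theorem1:
  fixes q :: "nat \<Rightarrow> real" and C :: nat and V :: "nat \<Rightarrow> policy \<Rightarrow> real"
  assumes "q 1 < 1" and "q 2 < q 1" and "0 < q 2" and "2 \<le> C"
    and "V \<in> {V_SLM 2 q, V_EAM 2 q}"
  shows "\<exists>\<pi> :: nat \<Rightarrow> policy.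
    (\<forall>\<tau>\<ge>1. optimal_policy 2 C (V \<tau>) (\<pi> \<tau>)) \<and>
    (\<forall>\<^sub>F \<tau> in sequentially. \<pi> \<tau> 1 {1, 2} 1 = C - 1 \<and> \<pi> \<tau> 1 {1, 2} 2 = 1) \<and>
    (\<forall>\<tau>\<ge>1. \<not> (\<pi> \<tau> 1 {1, 2} 1 = C \<and> \<pi> \<tau> 1 {1, 2} 2 = 0)) \<and>
    mono_on {1..} (\<lambda>\<tau>. \<pi> \<tau> 1 {1, 2} 1) \<and>
    antimono_on {1..} (\<lambda>\<tau>. \<pi> \<tau> 1 {1, 2} 2) \<and>
    (\<forall>\<tau>\<ge>1. \<pi> \<tau> 1 {1, 2} 2 \<le> \<pi> \<tau> 1 {1, 2} 1)"
proof (cases "V = V_SLM 2 q")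
  case True
  interpret two_threats "q 1" "q 2" 1 1 1 C
    using assms by unfold_locales auto
  show ?thesis
  proof (rule ex_optimal_policy)
    fix \<tau> :: nat and \<pi> :: policy
    assume \<pi>: "1 \<le> \<tau>" "\<pi> \<in> policies 2 C"
    \<comment> \<open>Demands are at least 1, so the three base values for horizon 0 all equal
      1.\<close>
    have "(\<integral>\<^sup>+r. of_bool (r \<noteq> (0, 0)) \<partial>M) = ennreal 1" if "(0, 0) \<notin> set_pmf M" for M :: "(nat \<times> nat) pmf"
    proof -
      have "(\<integral>\<^sup>+r. of_bool (r \<noteq> (0, 0)) \<partial>M) = (\<integral>\<^sup>+r. 1 \<partial>M)"
        using that by (intro nn_integral_cong_AE) (auto simp: AE_measure_pmf_iff)
      then show ?thesis by simp
    qed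
    from this[of "map_pmf (\<lambda>l. (l, 0)) (demand (q 1))"] this[of "map_pmf (\<lambda>l. (0, l)) (demand (q 2))"]
      this[of "pair_pmf (demand (q 1)) (demand (q 2))"]
    have "(\<integral>\<^sup>+l. of_bool ((l, 0 :: nat) \<noteq> (0, 0)) \<partial>demand (q 1)) = ennreal 1"
      "(\<integral>\<^sup>+l. of_bool ((0 :: nat, l) \<noteq> (0, 0)) \<partial>demand (q 2)) = ennreal 1"
      "(\<integral>\<^sup>+r. of_bool (r \<noteq> (0, 0)) \<partial>pair_pmf (demand (q 1)) (demand (q 2))) = ennreal 1"
      by (auto simp: demand_def)
    then have "(\<integral>\<^sup>+r. of_bool (residual \<pi> \<tau> 1 r \<noteq> (0, 0)) \<partial>pair_pmf (demand (q 1)) (demand (q 2))) =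
        ennreal (policy_loss \<pi> \<tau> 1)"
      using \<pi>(2) by (intro nn_integral_residual[where f = "\<lambda>r. of_bool (r \<noteq> (0, 0))"]) auto
    then show "V \<tau> \<pi> = 1 - policy_loss \<pi> \<tau> 1"
      unfolding True by (intro V_SLM_2[OF \<pi>(1) policy_loss_nonneg]) auto
  qed
next
  case False
  then have V: "V = V_EAM 2 q"
    using assms by simp
  \<comment> \<open>The parameters are the mean demands and their sum; both sides of the equation
    for \<open>\<kappa>\<close> vanish.\<close>
  interpret two_threats "q 1" "q 2" "1 / (1 - q 1)" "1 / (1 - q 2)" "1 / (1 - q 1) + 1 / (1 - q 2)" C
    using assms by unfold_locales (auto intro: divide_left_mono)
  let ?f = "\<lambda>r :: nat \<times> nat. ennreal (real (fst r)) + ennreal (real (snd r))"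
  show ?thesis
  proof (rule ex_optimal_policy)
    fix \<tau> :: nat and \<pi> :: policy
    assume \<pi>: "1 \<le> \<tau>" "\<pi> \<in> policies 2 C"
    have "(\<integral>\<^sup>+r. ?f (residual \<pi> \<tau> 1 r) \<partial>pair_pmf (demand (q 1)) (demand (q 2))) =
        ennreal (policy_loss \<pi> \<tau> 1)"
      using assms(1-3) \<pi>
      by (intro nn_integral_residual)
        (simp_all add: nn_integral_pair_pmf' nn_integral_add nn_integral_demand_real ennreal_plus)
    then show "V \<tau> \<pi> = 1 / (1 - q 1) + 1 / (1 - q 2) - policy_loss \<pi> \<tau> 1"
      unfolding V using assms(1-3)
      by (intro V_EAM_2 policy_loss_nonneg) auto
  qed
qed

end
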